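(* Let $\Omega\subset\mathbb{R}^3$ be a bounded domain, placed in the smallest box $I=(0,l_1)\times(0,l_2)\times(0,l_3)$ as described in the context. Let $\phi=(\phi_1,\phi_2,\phi_3)\in\mathring{\mathsf D}(\Omega)$. Then for every $i\in\{1,2,3\}$ and all $0\le\alpha_i<\beta_i\le l_i$, with $\Omega_i=\{x\in\Omega \mid \alpha_i<x_i<\beta_i\}$, $$\left|\int_{\Omega_i}\phi_i\,\mathrm{d}x\right|\le(\beta_i-\alpha_i)\,|\operatorname{div}\phi|_{\mathsf L^1(\Omega)} .$$
   Context: $\Omega$ is a bounded domain (open connected set) in $\mathbb{R}^3$; no boundary regularity is assumed. $\Omega$ is translated so that it is contained in the rectangular cuboid $I=(0,l_1)\times(0,l_2)\times(0,l_3)$, $0<l_1,l_2,l_3<\infty$, with $I$ as small as possible. $|\cdot|_{\mathsf L^1(\Omega)}$ is the norm of $\mathsf L^1(\Omega)$. $\mathsf D(\Omega)$ is the space of vector fields $\phi\in\mathsf L^2(\Omega)$ (with values in $\mathbb{R}^3$) whose weak divergence $\operatorname{div}\phi=\partial_1\phi_1+\partial_2\phi_2+\partial_3\phi_3$ belongs to $\mathsf L^2(\Omega)$. $\mathring{\mathsf D}(\Omega)$ is the closure in $\mathsf D(\Omega)$ of the smooth vector fields with compact support in $\Omega$, with respect to the graph norm $(|\phi|_{\mathsf L^2}^2+|\operatorname{div}\phi|_{\mathsf L^2}^2)^{1/2}$. *)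

theory Defs
  imports "HOL-Analysis.Analysis"
begin

definition partial_deriv :: "'n::finite \<Rightarrow> (real^'n \<Rightarrow> 'b::real_normed_vector) \<Rightarrow> real^'n \<Rightarrow> 'b" where
  "partial_deriv i f x = frechet_derivative f (at x) (axis i 1)"

fun C_times :: "nat \<Rightarrow> (real^'n::finite \<Rightarrow> 'b::real_normed_vector) \<Rightarrow> bool" where
  "C_times 0 f \<longleftrightarrow> continuous_on UNIV f"
| "C_times (Suc k) f \<longleftrightarrow>
     (\<forall>x. f differentiable (at x)) \<and> (\<forall>i. C_times k (partial_deriv i f))"

definition smooth :: "(real^'n::finite \<Rightarrow> 'b::real_normed_vector) \<Rightarrow> bool" where
  "smooth f \<longleftrightarrow> (\<forall>k. C_times k f)"

text \<open>Smooth functions with compact support in \<open>\<Omega>\<close>, identified with their extension by zero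
  to the whole space.\<close>

definition test_functions :: "(real^'n::finite) set \<Rightarrow> (real^'n \<Rightarrow> 'b::real_normed_vector) set" where
  "test_functions \<Omega> =
     {f. smooth f \<and> compact (closure {x. f x \<noteq> 0}) \<and> closure {x. f x \<noteq> 0} \<subseteq> \<Omega>}"

definition gradient :: "(real^'n::finite \<Rightarrow> real) \<Rightarrow> real^'n \<Rightarrow> real^'n" where
  "gradient f x = (\<chi> i. partial_deriv i f x)"

text \<open>Elements of the Lebesgue spaces are represented by functions; every notion below is
  invariant under changing a function on a null subset of \<open>\<Omega>\<close>.\<close>

definition L2 :: "(real^'n::finite) set \<Rightarrow> (real^'n \<Rightarrow> 'b::euclidean_space) set" where
  "L2 \<Omega> = {f. f \<in> borel_measurable (lebesgue_on \<Omega>) \<and>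
              integrable (lebesgue_on \<Omega>) (\<lambda>x. (norm (f x))\<^sup>2)}"

definition L2_norm :: "(real^'n::finite) set \<Rightarrow> (real^'n \<Rightarrow> 'b::euclidean_space) \<Rightarrow> real" where
  "L2_norm \<Omega> f = sqrt (LINT x|lebesgue_on \<Omega>. (norm (f x))\<^sup>2)"

definition L1_norm :: "(real^'n::finite) set \<Rightarrow> (real^'n \<Rightarrow> 'b::euclidean_space) \<Rightarrow> real" where
  "L1_norm \<Omega> f = (LINT x|lebesgue_on \<Omega>. norm (f x))"

definition has_weak_div ::
    "(real^'n::finite) set \<Rightarrow> (real^'n \<Rightarrow> real^'n) \<Rightarrow> (real^'n \<Rightarrow> real) \<Rightarrow> bool" where
  "has_weak_div \<Omega> \<phi> g \<longleftrightarrow>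
     (\<forall>\<theta> \<in> test_functions \<Omega>.
        (LINT x|lebesgue_on \<Omega>. \<phi> x \<bullet> gradient \<theta> x) = - (LINT x|lebesgue_on \<Omega>. g x * \<theta> x))"

definition D_space :: "(real^'n::finite) set \<Rightarrow> (real^'n \<Rightarrow> real^'n) set" where
  "D_space \<Omega> = {\<phi> \<in> L2 \<Omega>. \<exists>g \<in> L2 \<Omega>. has_weak_div \<Omega> \<phi> g}"

text \<open>The weak divergence is determined only almost everywhere, so a representative is chosen.
  It is meaningful only for \<open>\<phi> \<in> D_space \<Omega>\<close>.\<close>

definition weak_div :: "(real^'n::finite) set \<Rightarrow> (real^'n \<Rightarrow> real^'n) \<Rightarrow> real^'n \<Rightarrow> real" where
  "weak_div \<Omega> \<phi> = (SOME g. g \<in> L2 \<Omega> \<and> has_weak_div \<Omega> \<phi> g)"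

definition D_norm :: "(real^'n::finite) set \<Rightarrow> (real^'n \<Rightarrow> real^'n) \<Rightarrow> real" where
  "D_norm \<Omega> \<phi> = sqrt ((L2_norm \<Omega> \<phi>)\<^sup>2 + (L2_norm \<Omega> (weak_div \<Omega> \<phi>))\<^sup>2)"

definition D0_space :: "(real^'n::finite) set \<Rightarrow> (real^'n \<Rightarrow> real^'n) set" where
  "D0_space \<Omega> =
     {\<phi> \<in> D_space \<Omega>. \<forall>\<epsilon>>0. \<exists>\<psi> \<in> test_functions \<Omega>. D_norm \<Omega> (\<lambda>x. \<phi> x - \<psi> x) < \<epsilon>}"

definition smallest_box :: "(real^'n::finite) set \<Rightarrow> real^'n \<Rightarrow> bool" where
  "smallest_box \<Omega> l \<longleftrightarrow>
     (\<forall>i. 0 < l $ i) \<and> \<Omega> \<subseteq> box 0 l \<and> (\<forall>a b. \<Omega> \<subseteq> box a b \<longrightarrow> box 0 l \<subseteq> box a b)"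

end

theory Submission
  imports Defs
begin

text \<open>
  Let \<open>w(x) = max \<alpha> (min x\<^sub>i \<beta>) - \<alpha>\<close>. This weight takes values in \<open>[0, \<beta> - \<alpha>]\<close>, and its gradient is
  the unit vector \<open>e\<^sub>i\<close> inside the slab \<open>\<alpha> < x\<^sub>i < \<beta>\<close> and zero outside. Integration by parts against \<open>w\<close>
  therefore says that the integral of \<open>\<phi>\<^sub>i\<close> over the slab is minus the integral of \<open>w div \<phi>\<close> over
  \<open>\<Omega>\<close>, and the estimate follows from \<open>\<bar>w\<bar> \<le> \<beta> - \<alpha>\<close>. There are no boundary terms, although \<open>w\<close> does not
  vanish on the boundary, because \<open>\<phi>\<close> is a limit of fields with compact support in \<open>\<Omega>\<close>.

  For a smooth field \<open>\<psi>\<close> with compact support the identity is \<open>test_field_slab_identity\<close>, an instance of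
  the divergence theorem \<open>gauss_test_field\<close>. The latter reduces to the fact that a directional derivative
  of an integrable function has integral zero (\<open>integral_directional_derivative_eq_0\<close>).

  Passing to the limit (\<open>D0_slab_identity\<close>) requires that \<open>div \<psi>\<close> tends to the weak divergence of \<open>\<phi>\<close> when
  \<open>\<psi>\<close> tends to \<open>\<phi>\<close> in the graph norm. As the weak divergence is an arbitrarily chosen representative,
  this rests on its uniqueness up to null sets, that is, on the fundamental lemma of the calculus of
  variations \<open>AE_zero_if_orthogonal_to_test_functions\<close>: a function that is integrable on an open set and
  orthogonal to all test functions vanishes almost everywhere. Its proof approximates indicators of
  open sets by test functions, which are built from \<open>exp(-1/t)\<close>.
\<close>

section \<open>Smooth functions and bump functions\<close>

lemma partial_deriv_eq:
  assumes "(f has_derivative f') (at x)"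
  shows "partial_deriv i f x = f' (axis i 1)"
  using frechet_derivative_at[OF assms] by (simp add: partial_deriv_def)

text \<open>\<open>C_times (Suc k)\<close> asks for differentiability and for \<open>C_times k\<close> partial derivatives, but not for
  \<open>C_times k\<close> of the function itself; the following monotonicity is what makes the product rule
  below go through by induction.\<close>

lemma C_times_Suc_imp: "C_times (Suc k) f \<Longrightarrow> C_times k f"
proof (induction k arbitrary: f)
  case 0
  then show ?case
    by (auto intro!: continuous_at_imp_continuous_on differentiable_imp_continuous_within)
next
  case (Suc k)
  from Suc.prems have "f differentiable (at x)" "C_times (Suc k) (partial_deriv i f)" for x i
    by (auto simp only: C_times.simps(2))
  then show ?case using Suc.IH by auto
qed

lemma C_times_const: "C_times k (\<lambda>x. c)"
proof (induction k arbitrary: c)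
  case (Suc k)
  have "partial_deriv i (\<lambda>x. c) = (\<lambda>x. 0)" for i :: 'a
    by (rule ext, subst partial_deriv_eq[of _ "\<lambda>h. 0"]) auto
  then show ?case using Suc.IH[of 0] by simp
qed simp

lemma C_times_add:
  assumes "C_times k f" "C_times k g"
  shows "C_times k (\<lambda>x. f x + g x)"
  using assms
proof (induction k arbitrary: f g)
  case 0
  then show ?case by (auto intro: continuous_on_add)
next
  case (Suc k)
  have D: "f differentiable (at x)" "g differentiable (at x)" for x
    using Suc.prems by auto
  have "partial_deriv i (\<lambda>x. f x + g x) = (\<lambda>x. partial_deriv i f x + partial_deriv i g x)" for i
    unfolding partial_deriv_def[of i f] partial_deriv_def[of i g]
    by (intro ext partial_deriv_eq has_derivative_add)
       (use D in \<open>auto simp: frechet_derivative_works[symmetric]\<close>)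
  then show ?case using Suc D by auto
qed

lemma C_times_mult:
  fixes f g :: "real^'n::finite \<Rightarrow> real"
  assumes "C_times k f" "C_times k g"
  shows "C_times k (\<lambda>x. f x * g x)"
  using assms
proof (induction k arbitrary: f g)
  case 0
  then show ?case by (auto intro: continuous_on_mult)
next
  case (Suc k)
  have D: "f differentiable (at x)" "g differentiable (at x)" for x
    using Suc.prems by auto
  have eq: "partial_deriv i (\<lambda>x. f x * g x) =
        (\<lambda>x. f x * partial_deriv i g x + partial_deriv i f x * g x)" for i
    unfolding partial_deriv_def[of i f] partial_deriv_def[of i g]
    by (intro ext partial_deriv_eq has_derivative_mult)
       (use D in \<open>auto simp: frechet_derivative_works[symmetric]\<close>)
  have "C_times k f" "C_times k g" using Suc.prems C_times_Suc_imp by blast+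
  with Suc have "C_times k (partial_deriv i (\<lambda>x. f x * g x))" for i
    unfolding eq by (intro C_times_add Suc.IH) auto
  then show ?case using D by auto
qed

lemma C_times_component: "C_times k (\<lambda>x::real^'n::finite. x $ i)"
proof (cases k)
  case 0
  then show ?thesis by (auto intro: continuous_intros)
next
  case (Suc m)
  have d: "((\<lambda>x. x $ i) has_derivative (\<lambda>h. h $ i)) (at x)" for x :: "real^'n"
    by (rule bounded_linear_imp_has_derivative) (rule bounded_linear_vec_nth)
  then have "partial_deriv j (\<lambda>x. x $ i) = (\<lambda>x. axis j 1 $ i)" for j
    by (auto intro!: ext partial_deriv_eq)
  with d show ?thesis unfolding Suc
    by (auto simp: C_times_const intro: differentiableI)
qed

text \<open>The functions \<open>t \<mapsto> p(1/t) exp(-1/t)\<close>, extended by zero to \<open>t \<le> 0\<close>. The polynomial \<open>p\<close> is carried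
  along so that the class is closed under differentiation; \<open>p = 1\<close> is the usual flat function.\<close>
definition flat_exp :: "real poly \<Rightarrow> real \<Rightarrow> real" where
  "flat_exp p t = (if t > 0 then poly p (1/t) * exp (- (1/t)) else 0)"

lemma poly_exp_tendsto_0: "((\<lambda>s::real. poly p s * exp (- s)) \<longlongrightarrow> 0) at_top"
proof -
  have "((\<lambda>s::real. \<Sum>k\<le>degree p. coeff p k * (s ^ k / exp s)) \<longlongrightarrow> (\<Sum>k\<le>degree p. coeff p k * 0)) at_top"
    by (intro tendsto_intros tendsto_power_div_exp_0)
  then show ?thesis
    by (simp add: poly_altdef sum_distrib_right exp_minus divide_inverse mult.assoc)
qed

text \<open>For \<open>t > 0\<close>, the derivative of \<open>p(1/t) exp(-1/t)\<close> is \<open>(p - p')(1/t) exp(-1/t) / t\<^sup>2\<close>; at \<open>0\<close> the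
  exponential decay beats every polynomial in \<open>1/t\<close>.\<close>
lemma DERIV_flat_exp:
  "(flat_exp p has_real_derivative flat_exp ([:0,0,1:] * (p - pderiv p)) t) (at t)"
proof -
  consider "t > 0" | "t < 0" | "t = 0" by linarith
  then show ?thesis
  proof cases
    case 1
    have "((\<lambda>t. poly p (1/t) * exp (- (1/t))) has_real_derivative
        flat_exp ([:0,0,1:] * (p - pderiv p)) t) (at t)"
      using 1 by (auto intro!: derivative_eq_intros DERIV_chain'[OF _ poly_DERIV]
        simp: flat_exp_def field_simps power2_eq_square)
    then show ?thesis
      by (rule has_field_derivative_transform_within_open[where S = "{0<..}"])
         (use 1 in \<open>auto simp: flat_exp_def\<close>)
  next
    case 2
    have "((\<lambda>t. 0) has_real_derivative flat_exp ([:0,0,1:] * (p - pderiv p)) t) (at t)"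
      using 2 by (auto simp: flat_exp_def)
    then show ?thesis
      by (rule has_field_derivative_transform_within_open[where S = "{..<0}"])
         (use 2 in \<open>auto simp: flat_exp_def\<close>)
  next
    case 3
    have "((\<lambda>s. poly (pCons 0 p) s * exp (- s)) \<longlongrightarrow> 0) at_top"
      by (rule poly_exp_tendsto_0)
    then have "((\<lambda>h::real. poly (pCons 0 p) (inverse h) * exp (- inverse h)) \<longlongrightarrow> 0) (at_right 0)"
      by (rule filterlim_compose[OF _ filterlim_inverse_at_top_right])
    then have R: "((\<lambda>h. (flat_exp p (0 + h) - flat_exp p 0) / h) \<longlongrightarrow> 0) (at_right 0)"
      by (rule Lim_transform_eventually)
         (auto simp: flat_exp_def eventually_at_filter field_simps)
    have L: "((\<lambda>h. (flat_exp p (0 + h) - flat_exp p 0) / h) \<longlongrightarrow> 0) (at_left 0)"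
      by (rule Lim_transform_eventually[OF tendsto_const])
         (auto simp: flat_exp_def eventually_at_filter)
    from L R show ?thesis
      unfolding DERIV_def 3 by (simp add: flat_exp_def filterlim_split_at_real)
  qed
qed

lemma C_times_flat_exp_ball:
  fixes c :: "real^'n::finite"
  shows "C_times k (\<lambda>x. flat_exp p (r\<^sup>2 - (norm (x - c))\<^sup>2))"
proof (induction k arbitrary: p)
  case 0
  have "continuous_on UNIV (flat_exp p)"
    by (rule DERIV_continuous_on) (rule DERIV_flat_exp[THEN DERIV_subset], simp)
  then show ?case
    by (auto intro!: continuous_intros continuous_on_compose2[of UNIV "flat_exp p"])
next
  case (Suc k)
  let ?q = "[:0,0,1:] * (p - pderiv p)"
  have q: "((\<lambda>x. r\<^sup>2 - (norm (x - c))\<^sup>2) has_derivative (\<lambda>h. - 2 * ((x - c) \<bullet> h))) (at x)" for x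
    unfolding power2_norm_eq_inner
    by (auto intro!: derivative_eq_intros simp: inner_commute)
  have d: "((\<lambda>x. flat_exp p (r\<^sup>2 - (norm (x - c))\<^sup>2)) has_derivative
      (\<lambda>h. flat_exp ?q (r\<^sup>2 - (norm (x - c))\<^sup>2) * (- 2 * ((x - c) \<bullet> h)))) (at x)" for x
    using has_derivative_compose[OF q DERIV_flat_exp[unfolded has_field_derivative_def]] by simp
  have "partial_deriv i (\<lambda>x. flat_exp p (r\<^sup>2 - (norm (x - c))\<^sup>2)) =
      (\<lambda>x. flat_exp ?q (r\<^sup>2 - (norm (x - c))\<^sup>2) * (- 2 * (x $ i + - c $ i)))" for i
    by (rule ext, subst partial_deriv_eq[OF d]) (simp add: inner_axis)
  moreover have "C_times k (\<lambda>x. flat_exp ?q (r\<^sup>2 - (norm (x - c))\<^sup>2) * (- 2 * (x $ i + - c $ i)))" for i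
    by (intro C_times_mult C_times_add C_times_const C_times_component Suc.IH)
  ultimately show ?case
    using d by (auto simp del: mult_pCons_left intro: differentiableI)
qed

lemma test_functionsI:
  assumes "smooth f" "compact K" "K \<subseteq> \<Omega>" "\<And>x. x \<notin> K \<Longrightarrow> f x = 0"
  shows "f \<in> test_functions \<Omega>"
proof -
  have "closure {x. f x \<noteq> 0} \<subseteq> K"
    using assms by (intro closure_minimal) (auto simp: compact_imp_closed)
  with assms show ?thesis
    unfolding test_functions_def
    by (auto intro: closed_subset compact_closure[THEN iffD2] bounded_subset compact_imp_bounded
      simp: compact_eq_bounded_closed)
qed

lemma test_function_ball:
  assumes "cball c r \<subseteq> \<Omega>" "r > 0"
  obtains \<theta> :: "real^'n::finite \<Rightarrow> real"
    where "\<theta> \<in> test_functions \<Omega>" "\<And>x. 0 \<le> \<theta> x" "\<And>x. \<theta> x \<le> 1" "\<And>x. \<theta> x > 0 \<longleftrightarrow> x \<in> ball c r"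
proof
  let ?f = "\<lambda>x. flat_exp 1 (r\<^sup>2 - (norm (x - c))\<^sup>2)"
  show "?f \<in> test_functions \<Omega>"
  proof (rule test_functionsI[OF _ compact_cball assms(1)])
    show "smooth ?f" unfolding smooth_def using C_times_flat_exp_ball by blast
    show "?f x = 0" if "x \<notin> cball c r" for x
    proof -
      have "r \<le> norm (x - c)" using that by (simp add: dist_norm norm_minus_commute)
      then have "r\<^sup>2 \<le> (norm (x - c))\<^sup>2" using assms by (intro power_mono) auto
      then show ?thesis by (simp add: flat_exp_def)
    qed
  qed
  show "0 \<le> ?f x" "?f x \<le> 1" for x by (auto simp: flat_exp_def)
  show "?f x > 0 \<longleftrightarrow> x \<in> ball c r" for x
    using assms power2_less_imp_less[of "norm (x - c)" r] power_strict_mono[of "norm (x - c)" r 2]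
    by (auto simp: flat_exp_def dist_norm norm_minus_commute)
qed

text \<open>Test functions do not contain the constant \<open>1\<close>, but they are closed under
  \<open>f + g - f g = 1 - (1 - f)(1 - g)\<close>.\<close>
lemma test_functions_prob_or:
  fixes f g :: "real^'n::finite \<Rightarrow> real"
  assumes "f \<in> test_functions \<Omega>" "g \<in> test_functions \<Omega>"
  shows "(\<lambda>x. 1 - (1 - f x) * (1 - g x)) \<in> test_functions \<Omega>"
proof (rule test_functionsI)
  let ?K = "closure {x. f x \<noteq> 0} \<union> closure {x. g x \<noteq> 0}"
  show "compact ?K" "?K \<subseteq> \<Omega>" using assms by (auto simp: test_functions_def)
  have "C_times k (\<lambda>x. 1 + -1 * ((1 + -1 * f x) * (1 + -1 * g x)))" for k
    using assms by (intro C_times_add C_times_mult C_times_const)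
      (auto simp: test_functions_def smooth_def)
  then show "smooth (\<lambda>x. 1 - (1 - f x) * (1 - g x))" by (simp add: smooth_def)
  show "1 - (1 - f x) * (1 - g x) = 0" if "x \<notin> ?K" for x
  proof -
    have "f x = 0" "g x = 0"
      using that closure_subset[of "{x. f x \<noteq> 0}"] closure_subset[of "{x. g x \<noteq> 0}"] by blast+
    then show ?thesis by simp
  qed
qed

lemma test_functions_prod:
  fixes f :: "'i \<Rightarrow> real^'n::finite \<Rightarrow> real"
  assumes "finite I" "\<And>i. i \<in> I \<Longrightarrow> f i \<in> test_functions \<Omega>"
  shows "(\<lambda>x. 1 - (\<Prod>i\<in>I. 1 - f i x)) \<in> test_functions \<Omega>"
  using assms
proof (induction I)
  case empty
  show ?case by (rule test_functionsI[of _ "{}"]) (auto simp: smooth_def C_times_const)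
next
  case (insert i I)
  then show ?case using test_functions_prob_or[of "f i" \<Omega> "\<lambda>x. 1 - (\<Prod>i\<in>I. 1 - f i x)"] by auto
qed

text \<open>The indicator of an open set \<open>U\<close> is a bounded pointwise limit of test functions. Cover \<open>U\<close> by
  countably many balls whose closures lie in \<open>U\<close>, with bumps \<open>b\<^sub>1, b\<^sub>2, \<dots>\<close> positive exactly on them, and
  take \<open>\<theta>\<^sub>N = 1 - P\<^sub>N ^ N\<close>, where \<open>P\<^sub>N\<close> is the product of the \<open>1 - b\<^sub>n\<close> with \<open>n < N\<close>. At every
  point of \<open>U\<close> some factor is less than \<open>1\<close>, and the exponent \<open>N\<close> drives the power to \<open>0\<close>.\<close>
lemma test_functions_tendsto_indicator:
  fixes U :: "(real^'n::finite) set"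
  assumes "open U"
  obtains \<theta> :: "nat \<Rightarrow> real^'n::finite \<Rightarrow> real" where "\<And>N. \<theta> N \<in> test_functions U" "\<And>N x. \<bar>\<theta> N x\<bar> \<le> 1"
    "\<And>x. (\<lambda>N::nat. \<theta> N x) \<longlonglongrightarrow> indicator U x"
proof -
  define F where "F = {ball c r |c r. r > 0 \<and> cball c r \<subseteq> U}"
  have "\<Union>F = U"
  proof (intro equalityI subsetI)
    fix x assume "x \<in> U"
    then obtain e where "e > 0" "cball x e \<subseteq> U" using assms open_contains_cball by blast
    then have "ball x e \<in> F" "x \<in> ball x e" by (auto simp: F_def)
    then show "x \<in> \<Union>F" by blast
  qed (auto simp: F_def)
  moreover obtain F' where F': "F' \<subseteq> F" "countable F'" "\<Union>F' = \<Union>F"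
    using Lindelof[of F] by (auto simp: F_def)
  ultimately have UF: "\<Union>F' = U" by simp
  have "\<exists>\<theta> :: real^'n \<Rightarrow> real. \<theta> \<in> test_functions U \<and>
      (\<forall>x. 0 \<le> \<theta> x \<and> \<theta> x \<le> 1 \<and> (\<theta> x > 0 \<longleftrightarrow> x \<in> B))"
    if "B \<in> F'" for B
  proof -
    have "B \<in> F" using that F' by blast
    then obtain c r where "B = ball c r" "r > 0" "cball c r \<subseteq> U"
      unfolding F_def by blast
    moreover obtain \<theta> :: "real^'n \<Rightarrow> real" where "\<theta> \<in> test_functions U" "\<And>x. 0 \<le> \<theta> x"
        "\<And>x. \<theta> x \<le> 1" "\<And>x. \<theta> x > 0 \<longleftrightarrow> x \<in> ball c r"
      using test_function_ball[OF \<open>cball c r \<subseteq> U\<close> \<open>0 < r\<close>] by blast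
    ultimately show ?thesis by blast
  qed
  then obtain b :: "(real^'n) set \<Rightarrow> real^'n \<Rightarrow> real" where b: "\<And>B. B \<in> F' \<Longrightarrow> b B \<in> test_functions U"
    "\<And>B x. B \<in> F' \<Longrightarrow> 0 \<le> b B x \<and> b B x \<le> 1 \<and> (b B x > 0 \<longleftrightarrow> x \<in> B)"
    by metis
  define A where "A N = {B \<in> F'. to_nat_on F' B < N}" for N
  have finA: "finite (A N)" for N
  proof (rule finite_imageD)
    show "finite (to_nat_on F' ` A N)" by (rule finite_subset[of _ "{..<N}"]) (auto simp: A_def)
    show "inj_on (to_nat_on F') (A N)"
      using inj_on_to_nat_on[OF F'(2)] by (rule inj_on_subset) (auto simp: A_def)
  qed
  \<comment> \<open>The \<open>N\<close>-th power is written as a product, and its base as \<open>1 - (1 - \<dots>)\<close>, so that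
    \<open>test_functions_prod\<close> applies twice.\<close>
  define \<theta> where "\<theta> N x = 1 - (\<Prod>i<N. 1 - (1 - (\<Prod>B\<in>A N. 1 - b B x)))" for N :: nat and x
  have P: "0 \<le> (\<Prod>B\<in>A N. 1 - b B x)" "(\<Prod>B\<in>A N. 1 - b B x) \<le> 1" for N x
    using b(2) by (auto intro!: prod_nonneg prod_le_1 simp: A_def)
  have eq: "\<theta> N x = 1 - (\<Prod>B\<in>A N. 1 - b B x) ^ N" for N x by (simp add: \<theta>_def)
  show ?thesis
  proof
    fix N
    show "\<theta> N \<in> test_functions U"
      unfolding \<theta>_def using b(1) by (intro test_functions_prod finA) (auto simp: A_def)
    show "\<bar>\<theta> N x\<bar> \<le> 1" for x
      using P[of x N] power_le_one[of "(\<Prod>B\<in>A N. 1 - b B x)" N] by (auto simp: eq)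
  next
    fix x
    show "(\<lambda>N. \<theta> N x) \<longlonglongrightarrow> indicator U x"
    proof (cases "x \<in> U")
      case False
      then have "b B x = 0" if "B \<in> F'" for B
        using b(2)[OF that, of x] UF that by (metis UnionI less_eq_real_def)
      then have "\<theta> N x = 0" for N by (simp add: eq A_def)
      with False show ?thesis by simp
    next
      case True
      then obtain B where B: "B \<in> F'" "x \<in> B" using UF by auto
      have bB: "0 < b B x" "b B x \<le> 1" using b(2) B by auto
      have le: "(\<Prod>B\<in>A N. 1 - b B x) \<le> 1 - b B x" if "B \<in> A N" for N
      proof -
        have "(\<Prod>B\<in>A N. 1 - b B x) = (1 - b B x) * (\<Prod>B\<in>A N - {B}. 1 - b B x)"
          using that finA by (simp add: prod.remove)
        also have "\<dots> \<le> (1 - b B x) * 1"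
          using b(2) bB by (intro mult_left_mono prod_le_1) (auto simp: A_def)
        finally show ?thesis by simp
      qed
      have "(\<lambda>N. (\<Prod>B\<in>A N. 1 - b B x) ^ N) \<longlonglongrightarrow> 0"
      proof (rule tendsto_sandwich[OF _ _ tendsto_const])
        show "\<forall>\<^sub>F N in sequentially. 0 \<le> (\<Prod>B\<in>A N. 1 - b B x) ^ N" using P by auto
        show "\<forall>\<^sub>F N in sequentially. (\<Prod>B\<in>A N. 1 - b B x) ^ N \<le> (1 - b B x) ^ N"
          using eventually_gt_at_top[of "to_nat_on F' B"]
          by eventually_elim (use B P le in \<open>auto intro!: power_mono simp: A_def\<close>)
        show "(\<lambda>N. (1 - b B x) ^ N) \<longlonglongrightarrow> 0" using bB by (intro LIMSEQ_realpow_zero) auto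
      qed
      then have "(\<lambda>N. 1 - (\<Prod>B\<in>A N. 1 - b B x) ^ N) \<longlonglongrightarrow> 1 - 0" by (intro tendsto_intros)
      with True show ?thesis by (simp add: eq)
    qed
  qed
qed

section \<open>The fundamental lemma of the calculus of variations\<close>

lemma test_functions_mono: "U \<subseteq> V \<Longrightarrow> f \<in> test_functions U \<Longrightarrow> f \<in> test_functions V"
  by (auto simp: test_functions_def)

lemma AE_zero_if_orthogonal_to_test_functions:
  fixes u :: "real^'n::finite \<Rightarrow> real"
  assumes "open \<Omega>" and u: "integrable (lebesgue_on \<Omega>) u"
    and orth: "\<And>\<theta>. \<theta> \<in> test_functions \<Omega> \<Longrightarrow> (LINT x|lebesgue_on \<Omega>. u x * \<theta> x) = 0"
  shows "AE x in lebesgue_on \<Omega>. u x = 0"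
proof -
  have \<Omega>[measurable]: "\<Omega> \<in> sets borel" "\<Omega> \<in> sets lebesgue" using \<open>open \<Omega>\<close> by auto
  define v where "v x = indicator \<Omega> x *\<^sub>R u x" for x
  have v: "integrable lebesgue v"
    unfolding v_def using u by (simp add: integrable_restrict_space)
  \<comment> \<open>A Borel representative of the extension by zero of \<open>u\<close>, so that integrals over Borel sets can be
    treated by a Dynkin argument.\<close>
  then obtain v' where v'[measurable]: "v' \<in> borel_measurable lborel" and "AE x in lborel. v x = v' x"
    using completion_ex_borel_measurable_real[of v lborel] by auto
  then have AE: "AE x in lebesgue. v x = v' x" by (intro AE_completion)
  have v'm: "v' \<in> borel_measurable lebesgue" by (rule measurable_completion) fact
  have "integrable lebesgue v'"
    by (rule integrable_cong_AE_imp[OF v v'm]) (use AE in auto)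
  then have v'i: "integrable lborel v'" by (simp add: integrable_completion)
  \<comment> \<open>Over an open set, the integral is the limit of integrals against test functions in
    \<open>V \<inter> \<Omega>\<close>.\<close>
  have opn: "(LINT x:V|lborel. v' x) = 0" if "open V" for V
  proof -
    have [measurable]: "V \<in> sets borel" "V \<in> sets lebesgue" using that by auto
    obtain \<theta> :: "nat \<Rightarrow> real^'n \<Rightarrow> real" where \<theta>: "\<And>N. \<theta> N \<in> test_functions (V \<inter> \<Omega>)" "\<And>N x. \<bar>\<theta> N x\<bar> \<le> 1"
        "\<And>x. (\<lambda>N::nat. \<theta> N x) \<longlonglongrightarrow> indicator (V \<inter> \<Omega>) x"
      using test_functions_tendsto_indicator[of "V \<inter> \<Omega>"] \<open>open V\<close> \<open>open \<Omega>\<close> by auto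
    have m: "\<theta> N \<in> borel_measurable (lebesgue_on \<Omega>)" for N
    proof -
      have "C_times 0 (\<theta> N)" using \<theta>(1)[of N] unfolding test_functions_def smooth_def by blast
      then have "\<theta> N \<in> borel_measurable borel" by (simp add: borel_measurable_continuous_onI)
      then show ?thesis by (intro measurable_restrict_space1 measurable_completion) simp
    qed
    have um: "u \<in> borel_measurable (lebesgue_on \<Omega>)" using u by auto
    have "(\<lambda>N. LINT x|lebesgue_on \<Omega>. u x * \<theta> N x) \<longlonglongrightarrow> (LINT x|lebesgue_on \<Omega>. u x * indicator (V \<inter> \<Omega>) x)"
    proof (rule integral_dominated_convergence[where w = "\<lambda>x. \<bar>u x\<bar>"])
      show "integrable (lebesgue_on \<Omega>) (\<lambda>x. \<bar>u x\<bar>)" using u by simp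
      show "AE x in lebesgue_on \<Omega>. (\<lambda>N. u x * \<theta> N x) \<longlonglongrightarrow> u x * indicator (V \<inter> \<Omega>) x"
        using \<theta>(3) by (auto intro!: tendsto_intros)
      show "AE x in lebesgue_on \<Omega>. norm (u x * \<theta> N x) \<le> \<bar>u x\<bar>" for N
        using \<theta>(2) by (auto simp: abs_mult intro!: mult_left_le)
      have "(indicator (V \<inter> \<Omega>) :: _ \<Rightarrow> real) \<in> borel_measurable (lebesgue_on \<Omega>)"
        by (intro measurable_restrict_space1) measurable
      then show "(\<lambda>x. u x * indicator (V \<inter> \<Omega>) x) \<in> borel_measurable (lebesgue_on \<Omega>)"
        using um by measurable
      show "(\<lambda>x. u x * \<theta> N x) \<in> borel_measurable (lebesgue_on \<Omega>)" for N
        using um m by measurable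
    qed
    moreover have "(LINT x|lebesgue_on \<Omega>. u x * \<theta> N x) = 0" for N
      using \<theta>(1) by (intro orth test_functions_mono[of "V \<inter> \<Omega>" \<Omega>]) auto
    ultimately have 0: "(LINT x|lebesgue_on \<Omega>. u x * indicator (V \<inter> \<Omega>) x) = 0"
      by (simp add: LIMSEQ_const_iff)
    have "(LINT x:V|lborel. v' x) = (LINT x|lebesgue. indicator V x * v' x)"
      unfolding set_lebesgue_integral_def by (subst integral_completion) auto
    also have "\<dots> = (LINT x|lebesgue. indicator V x * v x)"
    proof (rule integral_cong_AE)
      show "(\<lambda>x. indicator V x * v' x) \<in> borel_measurable lebesgue" using v'm by measurable
      show "(\<lambda>x. indicator V x * v x) \<in> borel_measurable lebesgue" using v by measurable
    qed (use AE in auto)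
    also have "\<dots> = (LINT x|lebesgue_on \<Omega>. u x * indicator (V \<inter> \<Omega>) x)"
      by (subst integral_restrict_space)
         (auto simp: v_def indicator_inter_arith intro!: Bochner_Integration.integral_cong split: split_indicator)
    finally show ?thesis using 0 by simp
  qed
  \<comment> \<open>The open sets are intersection-stable and generate the Borel sets.\<close>
  have "(LINT x:A|lborel. v' x) = 0" if "A \<in> sets lborel" for A
  proof -
    have si: "set_integrable lborel B v'" if "B \<in> sets borel" for B
      using v'i that unfolding set_integrable_def by (intro integrable_mult_indicator) auto
    have "Int_stable {S::(real^'n) set. open S}" by (auto simp: Int_stable_def)
    moreover have "{S::(real^'n) set. open S} \<subseteq> Pow UNIV" by simp
    moreover have "A \<in> sigma_sets UNIV {S. open S}" using that by (simp add: borel_def)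
    ultimately show ?thesis
    proof (induction rule: sigma_sets_induct_disjoint)
      case (basic A)
      then show ?case by (simp add: opn)
    next
      case (compl A)
      then have A: "A \<in> sets borel" by (simp add: borel_def)
      have "(LINT x:A \<union> (UNIV - A)|lborel. v' x) = (LINT x:A|lborel. v' x) + (LINT x:UNIV - A|lborel. v' x)"
        using A by (intro set_integral_Un si) auto
      with compl opn[of UNIV] show ?case by simp
    next
      case (union A)
      have A: "A i \<in> sets borel" for i using union(2) by (auto simp: borel_def)
      have "(LINT x:(\<Union>i. A i)|lborel. v' x) = (\<Sum>i. LINT x:A i|lborel. v' x)"
        using A union(1) by (intro lebesgue_integral_countable_add si) (auto simp: disjoint_family_on_def)
      with union(3) show ?case by simp
    qed (auto simp: set_lebesgue_integral_def)
  qed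
  then have "AE x in lborel. v' x = 0" by (rule sigma_finite_measure.density_zero[OF sigma_finite_lborel v'i])
  then have "AE x in lebesgue. v' x = 0" by (rule AE_completion)
  with AE have "AE x in lebesgue. v x = 0" by eventually_elim simp
  then have "AE x in lebesgue. x \<in> \<Omega> \<longrightarrow> u x = 0" by eventually_elim (auto simp: v_def)
  then show ?thesis by (simp add: AE_restrict_space_iff)
qed

section \<open>A divergence theorem for compactly supported fields\<close>

lemma lborel_translation:
  fixes f :: "'a::euclidean_space \<Rightarrow> real"
  assumes "integrable lborel f"
  shows "integrable lborel (\<lambda>x. f (x + c))" "(LINT x|lborel. f (x + c)) = integral\<^sup>L lborel f"
proof -
  have [measurable]: "f \<in> borel_measurable borel" using assms by auto
  have "integrable (distr lborel borel ((+) c)) f" using assms by (simp add: lborel_distr_plus)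
  then show "integrable lborel (\<lambda>x. f (x + c))"
    by (subst (asm) integrable_distr_eq) (auto simp: add.commute)
  have "integral\<^sup>L (distr lborel borel ((+) c)) f = (LINT x|lborel. f (c + x))"
    by (rule integral_distr) auto
  then show "(LINT x|lborel. f (x + c)) = integral\<^sup>L lborel f"
    by (simp add: lborel_distr_plus add.commute)
qed

text \<open>If \<open>f'\<close> is a derivative of \<open>f\<close> in direction \<open>e\<close>, in the sense that the fundamental theorem of
  calculus holds on all segments from \<open>x\<close> to \<open>x + e\<close>, then \<open>f'\<close> has integral zero. No splitting of
  the space into coordinates is needed: by translation invariance, the integral of \<open>f'\<close> is that of
  \<open>f'(x + t e)\<close> for every \<open>t\<close>; averaging over \<open>t \<in> [0,1]\<close> and exchanging the integrals gives the integral
  of \<open>f(x + e) - f(x)\<close>, which vanishes by translation invariance again.\<close>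
lemma integral_directional_derivative_eq_0:
  fixes f f' :: "'a::euclidean_space \<Rightarrow> real"
  assumes f: "integrable lborel f" and f': "integrable lborel f'"
    and FTC: "\<And>x. ((\<lambda>t. f' (x + t *\<^sub>R e)) has_integral f (x + e) - f x) {0..1}"
  shows "integral\<^sup>L lborel f' = 0"
proof -
  have [measurable]: "f' \<in> borel_measurable borel" using f' by auto
  let ?g = "\<lambda>(t::real, x). indicator {0..1} t *\<^sub>R f' (x + t *\<^sub>R e)"
  have int: "integrable (lborel \<Otimes>\<^sub>M lborel) ?g"
  proof (rule lborel_pair.Fubini_integrable)
    show "?g \<in> borel_measurable (lborel \<Otimes>\<^sub>M lborel)" by measurable
    have "(LINT x|lborel. norm (?g (t, x))) = indicator {0..1} t *\<^sub>R (LINT x|lborel. \<bar>f' x\<bar>)" for t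
      using lborel_translation(2)[of "\<lambda>x. \<bar>f' x\<bar>" "t *\<^sub>R e"] f' by (simp add: abs_mult)
    then show "integrable lborel (\<lambda>t. LINT x|lborel. norm (?g (t, x)))"
      by (simp only:) (rule integrableI_bounded_set_indicator[where B = "LINT x|lborel. \<bar>f' x\<bar>"], auto)
    show "AE t in lborel. integrable lborel (\<lambda>x. ?g (t, x))"
      using lborel_translation(1)[OF f'] by auto
  qed
  have "(LINT x|lborel. ?g (t, x)) = indicator {0..1} t *\<^sub>R integral\<^sup>L lborel f'" for t
    using lborel_translation(2)[OF f', of "t *\<^sub>R e"] by simp
  then have "(LINT t|lborel. LINT x|lborel. ?g (t, x)) = 
      (LINT t::real|lborel. indicator {0..1} t *\<^sub>R integral\<^sup>L lborel f')"
    by (simp only:)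
  also have "\<dots> = integral\<^sup>L lborel f'"
    by simp
  finally have "integral\<^sup>L lborel f' = (LINT t|lborel. LINT x|lborel. ?g (t, x))" ..
  also have "\<dots> = (LINT x|lborel. LINT t|lborel. ?g (t, x))"
    using lborel_pair.Fubini_integral[of "\<lambda>t x. ?g (t, x)"] int by simp
  also have "\<dots> = (LINT x|lborel. f (x + e) - f x)"
  proof (rule integral_cong_AE)
    have "AE x in lborel. integrable lborel (\<lambda>t. ?g (t, x))"
      using lborel_pair.AE_integrable_snd[of "\<lambda>t x. ?g (t, x)"] int by simp
    then show "AE x in lborel. (LINT t|lborel. ?g (t, x)) = f (x + e) - f x"
    proof eventually_elim
      case (elim x)
      then have "set_integrable lborel {0..1} (\<lambda>t. f' (x + t *\<^sub>R e))"
        by (simp add: set_integrable_def)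
      from set_borel_integral_eq_integral(2)[OF this] FTC[of x] show ?case
        by (simp add: set_lebesgue_integral_def integral_unique)
    qed
    show "(\<lambda>x. LINT t|lborel. ?g (t, x)) \<in> borel_measurable lborel" by measurable
    show "(\<lambda>x. f (x + e) - f x) \<in> borel_measurable lborel"
      using lborel_translation(1)[OF f] f by measurable
  qed
  also have "\<dots> = 0"
    using lborel_translation[OF f] f by simp
  finally show ?thesis .
qed

lemma integrable_compact_support:
  fixes f :: "'a::euclidean_space \<Rightarrow> 'b::{banach, second_countable_topology}"
  assumes "compact K" "continuous_on UNIV f" "\<And>x. x \<notin> K \<Longrightarrow> f x = 0"
  shows "integrable lborel f"
proof -
  have "continuous_on K f" using assms(2) by (rule continuous_on_subset) simp
  then have "integrable lborel (\<lambda>x. indicator K x *\<^sub>R f x)"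
    by (rule borel_integrable_compact[OF assms(1)])
  moreover have "(\<lambda>x. indicator K x *\<^sub>R f x) = f"
    using assms(3) by (auto simp: indicator_def fun_eq_iff)
  ultimately show ?thesis by simp
qed

lemma bounded_compact_support:
  fixes f :: "'a::topological_space \<Rightarrow> 'b::real_normed_vector"
  assumes "compact K" "continuous_on UNIV f" "\<And>x. x \<notin> K \<Longrightarrow> f x = 0"
  obtains B where "\<And>x. norm (f x) \<le> B"
proof -
  have "continuous_on K f" using assms(2) by (rule continuous_on_subset) simp
  then have "bounded (f ` K)"
    using assms(1) by (intro compact_imp_bounded compact_continuous_image)
  then obtain B where "B > 0" "\<And>x. x \<in> K \<Longrightarrow> norm (f x) \<le> B"
    unfolding bounded_pos by auto
  then have "norm (f x) \<le> B" for x
    using assms(3)[of x] by (cases "x \<in> K") auto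
  then show ?thesis by (rule that)
qed

lemma test_functionsD:
  fixes f :: "real^'n::finite \<Rightarrow> 'b::real_normed_vector"
  assumes "f \<in> test_functions \<Omega>"
  obtains K where "compact K" "K \<subseteq> \<Omega>" "\<And>x. x \<notin> K \<Longrightarrow> f x = 0"
    "\<And>x i. x \<notin> K \<Longrightarrow> partial_deriv i f x = 0"
    "continuous_on UNIV f" "\<And>x. f differentiable (at x)" "\<And>i. continuous_on UNIV (partial_deriv i f)"
proof (rule that)
  let ?K = "closure {x. f x \<noteq> 0}"
  show "compact ?K" "?K \<subseteq> \<Omega>" using assms by (auto simp: test_functions_def)
  show 0: "f x = 0" if "x \<notin> ?K" for x
    using that closure_subset[of "{x. f x \<noteq> 0}"] by auto
  show "partial_deriv i f x = 0" if "x \<notin> ?K" for x i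
  proof -
    have "((\<lambda>x. 0) has_derivative (\<lambda>h. 0)) (at x)" by simp
    then have "(f has_derivative (\<lambda>h. 0)) (at x)"
    proof (rule has_derivative_transform_within_open)
      show "open (- ?K)" "x \<in> - ?K" using that by auto
      show "0 = f y" if "y \<in> - ?K" for y using 0[of y] that by simp
    qed
    from partial_deriv_eq[OF this] show ?thesis by simp
  qed
  have C: "C_times k f" for k using assms by (auto simp: test_functions_def smooth_def)
  show "continuous_on UNIV f" using C[of 0] by simp
  show "f differentiable (at x)" "continuous_on UNIV (partial_deriv i f)" for x i
    using C[of "Suc 0"] by auto
qed

text \<open>The pointwise divergence of a differentiable vector field.\<close>
definition classical_div :: "(real^'n::finite \<Rightarrow> real^'n) \<Rightarrow> real^'n \<Rightarrow> real" where
  "classical_div \<psi> x = (\<Sum>j\<in>UNIV. partial_deriv j \<psi> x $ j)"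

lemma DERIV_along_axis:
  fixes f :: "real^'n::finite \<Rightarrow> 'b::real_normed_vector"
  assumes "f differentiable (at (x + t *\<^sub>R axis j 1))"
  shows "((\<lambda>t. f (x + t *\<^sub>R axis j 1)) has_vector_derivative partial_deriv j f (x + t *\<^sub>R axis j 1)) (at t)"
proof -
  have d: "(f has_derivative frechet_derivative f (at (x + t *\<^sub>R axis j 1))) (at (x + t *\<^sub>R axis j 1))"
    using assms by (simp add: frechet_derivative_works)
  have "((\<lambda>t. x + t *\<^sub>R axis j 1) has_vector_derivative axis j 1) (at t)"
    by (auto intro!: derivative_eq_intros)
  then have "((f \<circ> (\<lambda>t. x + t *\<^sub>R axis j 1)) has_vector_derivative
      frechet_derivative f (at (x + t *\<^sub>R axis j 1)) (axis j 1)) (at t)"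
    using d by (intro vector_derivative_diff_chain_within) (auto intro: has_derivative_at_withinI)
  then show ?thesis by (simp add: partial_deriv_def o_def)
qed

text \<open>Integration by parts of a test field against a continuous weight \<open>v\<close>. The weight need not be smooth:
  on each line parallel to an axis it may fail to be differentiable at finitely many points. This
  covers both test functions and truncated coordinates.\<close>
lemma gauss_test_field:
  fixes \<psi> :: "real^'n::finite \<Rightarrow> real^'n" and v :: "real^'n \<Rightarrow> real"
  assumes "\<psi> \<in> test_functions \<Omega>" and v: "continuous_on UNIV v"
    and D[measurable]: "\<And>j. D j \<in> borel_measurable borel" and B: "\<And>j x. \<bar>D j x\<bar> \<le> B"
    and deriv: "\<And>j x. \<exists>S. finite S \<and> (\<forall>t. t \<notin> S \<longrightarrow>
      ((\<lambda>t. v (x + t *\<^sub>R axis j 1)) has_real_derivative D j (x + t *\<^sub>R axis j 1)) (at t))"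
  shows "(LINT x|lborel. classical_div \<psi> x * v x + (\<Sum>j\<in>UNIV. \<psi> x $ j * D j x)) = 0"
proof -
  obtain K where K: "compact K" "\<And>x. x \<notin> K \<Longrightarrow> \<psi> x = 0" "\<And>x i. x \<notin> K \<Longrightarrow> partial_deriv i \<psi> x = 0"
    and c: "continuous_on UNIV \<psi>" "\<And>i. continuous_on UNIV (partial_deriv i \<psi>)"
    and d: "\<And>x. \<psi> differentiable (at x)"
    using test_functionsD[OF assms(1)] by metis
  let ?f = "\<lambda>j x. \<psi> x $ j * v x"
  let ?f' = "\<lambda>j x. partial_deriv j \<psi> x $ j * v x + \<psi> x $ j * D j x"
  have i\<psi>: "integrable lborel (\<lambda>x. \<psi> x $ j)" for j
    by (rule integrable_compact_support[OF K(1)]) (use K c in \<open>auto intro!: continuous_intros\<close>)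
  have int': "integrable lborel (?f' j)" for j
  proof (rule Bochner_Integration.integrable_add)
    show "integrable lborel (\<lambda>x. partial_deriv j \<psi> x $ j * v x)"
      by (rule integrable_compact_support[OF K(1)]) (use K c v in \<open>auto intro!: continuous_intros\<close>)
    have "integrable lborel (\<lambda>x. B * (\<psi> x $ j))" using i\<psi> by simp
    then show "integrable lborel (\<lambda>x. \<psi> x $ j * D j x)"
    proof (rule Bochner_Integration.integrable_bound)
      show "(\<lambda>x. \<psi> x $ j * D j x) \<in> borel_measurable lborel"
        using i\<psi>[of j] by measurable
      show "AE x in lborel. norm (\<psi> x $ j * D j x) \<le> norm (B * (\<psi> x $ j))"
      proof (rule AE_I2)
        fix x
        have "\<bar>D j x\<bar> \<le> \<bar>B\<bar>" using B[of j x] by linarith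
        then show "norm (\<psi> x $ j * D j x) \<le> norm (B * (\<psi> x $ j))"
          by (simp add: abs_mult mult.commute mult_right_mono)
      qed
    qed
  qed
  have "integral\<^sup>L lborel (?f' j) = 0" for j
  proof (rule integral_directional_derivative_eq_0[where e = "axis j 1", OF _ int'])
    show "integrable lborel (?f j)"
      by (rule integrable_compact_support[OF K(1)]) (use K c v in \<open>auto intro!: continuous_intros\<close>)
    fix x
    let ?y = "\<lambda>t. x + t *\<^sub>R axis j (1::real)"
    obtain S where S: "finite S" "\<And>t. t \<notin> S \<Longrightarrow> ((\<lambda>t. v (?y t)) has_real_derivative D j (?y t)) (at t)"
      using deriv[of x j] by blast
    have "((\<lambda>t. ?f' j (?y t)) has_integral ?f j (?y 1) - ?f j (?y 0)) {0..1}"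
    proof (rule fundamental_theorem_of_calculus_interior_strong[OF S(1)])
      show "continuous_on {0..1} (\<lambda>t. ?f j (?y t))"
        using c v by (auto intro!: continuous_intros continuous_on_compose2[of UNIV \<psi>] continuous_on_compose2[of UNIV v])
      fix t assume "t \<in> {0<..<1} - S"
      then have "((\<lambda>t. v (?y t)) has_real_derivative D j (?y t)) (at t)" using S by auto
      moreover have "((\<lambda>t. \<psi> (?y t) $ j) has_real_derivative partial_deriv j \<psi> (?y t) $ j) (at t)"
        using bounded_linear.has_vector_derivative[OF bounded_linear_vec_nth DERIV_along_axis[OF d]]
        by (simp add: has_real_derivative_iff_has_vector_derivative)
      ultimately show "((\<lambda>t. ?f j (?y t)) has_vector_derivative ?f' j (?y t)) (at t)"
        unfolding has_real_derivative_iff_has_vector_derivative[symmetric]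
        by (auto intro!: derivative_eq_intros)
    qed simp
    then show "((\<lambda>t. ?f' j (x + t *\<^sub>R axis j 1)) has_integral ?f j (x + axis j 1) - ?f j x) {0..1}"
      by simp
  qed
  then have "(LINT x|lborel. (\<Sum>j\<in>UNIV. ?f' j x)) = 0"
    using int' by (subst Bochner_Integration.integral_sum) auto
  then show ?thesis
    by (simp add: classical_div_def sum.distrib sum_distrib_right)
qed

section \<open>Square integrable functions on a set of finite measure\<close>

lemma borel_measurable_lebesgue_onI:
  "f \<in> borel_measurable borel \<Longrightarrow> f \<in> borel_measurable (lebesgue_on \<Omega>)"
  by (intro measurable_restrict_space1 measurable_completion) simp

lemma integral_lebesgue_on_eq_lborel:
  fixes f :: "'a::euclidean_space \<Rightarrow> real"
  assumes "\<Omega> \<in> sets lebesgue" "f \<in> borel_measurable borel" "\<And>x. x \<notin> \<Omega> \<Longrightarrow> f x = 0"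
  shows "integral\<^sup>L (lebesgue_on \<Omega>) f = integral\<^sup>L lborel f"
    and "integrable (lebesgue_on \<Omega>) f \<longleftrightarrow> integrable lborel f"
proof -
  have "(\<lambda>x. indicator \<Omega> x *\<^sub>R f x) = f" using assms(3) by (auto simp: indicator_def fun_eq_iff)
  moreover have "\<Omega> \<inter> space lebesgue \<in> sets lebesgue" "f \<in> lborel \<rightarrow>\<^sub>M borel"
    using assms(1,2) by simp_all
  ultimately show "integral\<^sup>L (lebesgue_on \<Omega>) f = integral\<^sup>L lborel f"
    "integrable (lebesgue_on \<Omega>) f \<longleftrightarrow> integrable lborel f"
    by (simp_all only: integral_restrict_space integrable_restrict_space integral_completion
        integrable_completion)
qed

lemma L2_compact_support:
  fixes f :: "real^'n::finite \<Rightarrow> 'b::euclidean_space"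
  assumes "\<Omega> \<in> sets lebesgue" "compact K" "K \<subseteq> \<Omega>" "continuous_on UNIV f" "\<And>x. x \<notin> K \<Longrightarrow> f x = 0"
  shows "f \<in> L2 \<Omega>"
proof -
  have [measurable]: "f \<in> borel_measurable borel" using assms by (intro borel_measurable_continuous_onI)
  have "integrable lborel (\<lambda>x. (norm (f x))\<^sup>2)"
    by (rule integrable_compact_support[OF assms(2)]) (use assms in \<open>auto intro!: continuous_intros\<close>)
  then have "integrable (lebesgue_on \<Omega>) (\<lambda>x. (norm (f x))\<^sup>2)"
    using assms by (subst integral_lebesgue_on_eq_lborel(2)) auto
  then show ?thesis by (auto simp: L2_def intro: borel_measurable_lebesgue_onI)
qed

lemma L2_diff:
  assumes "f \<in> L2 \<Omega>" "g \<in> L2 \<Omega>"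
  shows "(\<lambda>x. f x - g x) \<in> L2 \<Omega>"
proof -
  let ?M = "lebesgue_on \<Omega>"
  have [measurable]: "f \<in> borel_measurable ?M" "g \<in> borel_measurable ?M"
    using assms by (auto simp: L2_def)
  have "integrable ?M (\<lambda>x. 2 * (norm (f x))\<^sup>2 + 2 * (norm (g x))\<^sup>2)"
    using assms by (auto simp: L2_def)
  then have "integrable ?M (\<lambda>x. (norm (f x - g x))\<^sup>2)"
  proof (rule Bochner_Integration.integrable_bound)
    have "(norm (f x - g x))\<^sup>2 \<le> 2 * (norm (f x))\<^sup>2 + 2 * (norm (g x))\<^sup>2" for x
    proof -
      have "(norm (f x - g x))\<^sup>2 \<le> (norm (f x) + norm (g x))\<^sup>2"
        by (intro power_mono norm_triangle_ineq4) auto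
      also have "\<dots> \<le> 2 * (norm (f x))\<^sup>2 + 2 * (norm (g x))\<^sup>2"
        using zero_le_power2[of "norm (f x) - norm (g x)"] by (simp add: power2_sum power2_diff)
      finally show ?thesis .
    qed
    then show "AE x in ?M. norm ((norm (f x - g x))\<^sup>2) \<le> norm (2 * (norm (f x))\<^sup>2 + 2 * (norm (g x))\<^sup>2)"
      by auto
  qed measurable
  then show ?thesis by (auto simp: L2_def)
qed

lemma L2_imp_L1:
  fixes f :: "real^'n::finite \<Rightarrow> 'b::euclidean_space"
  assumes "f \<in> L2 \<Omega>" "\<Omega> \<in> lmeasurable"
  shows "integrable (lebesgue_on \<Omega>) f"
proof -
  let ?M = "lebesgue_on \<Omega>"
  interpret finite_measure ?M using assms(2) by (rule finite_measure_lebesgue_on)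
  have "integrable ?M (\<lambda>x. 1 + (norm (f x))\<^sup>2)" using assms by (auto simp: L2_def)
  then show ?thesis
  proof (rule Bochner_Integration.integrable_bound)
    have "norm (f x) \<le> 1 + (norm (f x))\<^sup>2" for x
    proof -
      have "0 \<le> (norm (f x))\<^sup>2 - 2 * norm (f x) + 1"
        using zero_le_power2[of "norm (f x) - 1"] by (simp add: power2_diff)
      then show ?thesis using norm_ge_zero[of "f x"] by linarith
    qed
    then show "AE x in ?M. norm (f x) \<le> norm (1 + (norm (f x))\<^sup>2)" by auto
    show "f \<in> borel_measurable ?M" using assms by (auto simp: L2_def)
  qed
qed

text \<open>A form of the Cauchy--Schwarz inequality that is sufficient for limits: integrate
  \<open>2 \<epsilon> \<bar>f\<bar> \<le> \<epsilon>\<^sup>2 + \<bar>f\<bar>\<^sup>2\<close>.\<close>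
lemma L1_norm_le_of_L2_norm_le:
  fixes f :: "real^'n::finite \<Rightarrow> 'b::euclidean_space"
  assumes "f \<in> L2 \<Omega>" "\<Omega> \<in> lmeasurable" "L2_norm \<Omega> f \<le> \<epsilon>" "\<epsilon> > 0"
  shows "L1_norm \<Omega> f \<le> \<epsilon> * (measure lebesgue \<Omega> + 1) / 2"
proof -
  let ?M = "lebesgue_on \<Omega>"
  interpret finite_measure ?M using assms(2) by (rule finite_measure_lebesgue_on)
  have i: "integrable ?M (\<lambda>x. (norm (f x))\<^sup>2)" using assms by (auto simp: L2_def)
  have n: "0 \<le> (LINT x|?M. (norm (f x))\<^sup>2)" by (intro integral_nonneg_AE) auto
  have m: "measure ?M (space ?M) = measure lebesgue \<Omega>"
    using assms(2) by (simp add: measure_restrict_space)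
  have "L1_norm \<Omega> f \<le> (LINT x|?M. \<epsilon> / 2 + (norm (f x))\<^sup>2 / (2 * \<epsilon>))"
    unfolding L1_norm_def
  proof (rule integral_mono)
    show "norm (f x) \<le> \<epsilon> / 2 + (norm (f x))\<^sup>2 / (2 * \<epsilon>)" for x
      using zero_le_power2[of "norm (f x) - \<epsilon>"] assms(4)
      by (simp add: power2_diff field_simps power2_eq_square)
  qed (use i L2_imp_L1[OF assms(1,2)] in auto)
  also have "\<dots> = \<epsilon> / 2 * measure lebesgue \<Omega> + (L2_norm \<Omega> f)\<^sup>2 / (2 * \<epsilon>)"
    using i n m by (simp add: L2_norm_def)
  also have "\<dots> \<le> \<epsilon> / 2 * measure lebesgue \<Omega> + \<epsilon>\<^sup>2 / (2 * \<epsilon>)"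
    using assms(3,4) n by (intro add_left_mono divide_right_mono power_mono) (auto simp: L2_norm_def)
  also have "\<dots> = \<epsilon> * (measure lebesgue \<Omega> + 1) / 2"
    using assms(4) by (simp add: field_simps power2_eq_square)
  finally show ?thesis .
qed

lemma integrable_L2_inner_bounded:
  fixes f :: "real^'n::finite \<Rightarrow> 'b::euclidean_space"
  assumes "f \<in> L2 \<Omega>" "\<Omega> \<in> lmeasurable" "g \<in> borel_measurable borel" "\<And>x. x \<in> \<Omega> \<Longrightarrow> norm (g x) \<le> B"
  shows "integrable (lebesgue_on \<Omega>) (\<lambda>x. f x \<bullet> g x)"
proof -
  have f: "integrable (lebesgue_on \<Omega>) f" using assms by (simp add: L2_imp_L1)
  have g: "g \<in> borel_measurable (lebesgue_on \<Omega>)" using assms by (simp add: borel_measurable_lebesgue_onI)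
  have "integrable (lebesgue_on \<Omega>) (\<lambda>x. B *\<^sub>R f x)" using f by simp
  then show ?thesis
  proof (rule Bochner_Integration.integrable_bound)
    show "(\<lambda>x. f x \<bullet> g x) \<in> borel_measurable (lebesgue_on \<Omega>)" using f g by measurable
    show "AE x in lebesgue_on \<Omega>. norm (f x \<bullet> g x) \<le> norm (B *\<^sub>R f x)"
    proof (rule AE_I2)
      fix x assume "x \<in> space (lebesgue_on \<Omega>)"
      then have "norm (g x) \<le> \<bar>B\<bar>" using assms(4)[of x] by auto
      then have "norm (f x) * norm (g x) \<le> norm (f x) * \<bar>B\<bar>" by (intro mult_left_mono) auto
      then show "norm (f x \<bullet> g x) \<le> norm (B *\<^sub>R f x)"
        using Cauchy_Schwarz_ineq2[of "f x" "g x"] by (simp add: mult.commute)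
    qed
  qed
qed

section \<open>Weak divergences\<close>

lemma test_function_gradient:
  fixes \<theta> :: "real^'n::finite \<Rightarrow> real"
  assumes "\<theta> \<in> test_functions \<Omega>"
  obtains B where "\<theta> \<in> borel_measurable borel" "gradient \<theta> \<in> borel_measurable borel"
    "\<And>x. norm (\<theta> x) \<le> B" "\<And>x. norm (gradient \<theta> x) \<le> B"
proof -
  obtain K where K: "compact K" "\<And>x. x \<notin> K \<Longrightarrow> \<theta> x = 0" "\<And>x i. x \<notin> K \<Longrightarrow> partial_deriv i \<theta> x = 0"
    and c: "continuous_on UNIV \<theta>" "\<And>i. continuous_on UNIV (partial_deriv i \<theta>)"
    using test_functionsD[OF assms(1)] by metis
  have g: "continuous_on UNIV (gradient \<theta>)"
    unfolding gradient_def using c by (intro continuous_intros) auto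
  have g0: "gradient \<theta> x = 0" if "x \<notin> K" for x
    using K(3)[OF that] by (simp add: gradient_def vec_eq_iff)
  obtain B1 where "\<And>x. norm (\<theta> x) \<le> B1" using bounded_compact_support[OF K(1) c(1) K(2)] by metis
  moreover obtain B2 where "\<And>x. norm (gradient \<theta> x) \<le> B2"
    using bounded_compact_support[OF K(1) g g0] by metis
  ultimately have "norm (\<theta> x) \<le> max B1 B2" "norm (gradient \<theta> x) \<le> max B1 B2" for x
    by (simp_all add: le_max_iff_disj)
  with c(1) g show ?thesis by (intro that) (auto intro: borel_measurable_continuous_onI)
qed

lemma has_weak_div_diff:
  assumes "\<Omega> \<in> lmeasurable" "\<phi> \<in> L2 \<Omega>" "\<psi> \<in> L2 \<Omega>" "g \<in> L2 \<Omega>" "h \<in> L2 \<Omega>"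
    and "has_weak_div \<Omega> \<phi> g" "has_weak_div \<Omega> \<psi> h"
  shows "has_weak_div \<Omega> (\<lambda>x. \<phi> x - \<psi> x) (\<lambda>x. g x - h x)"
  unfolding has_weak_div_def
proof
  fix \<theta> :: "real^'a \<Rightarrow> real" assume \<theta>: "\<theta> \<in> test_functions \<Omega>"
  obtain B where B: "\<theta> \<in> borel_measurable borel" "gradient \<theta> \<in> borel_measurable borel"
    "\<And>x. norm (\<theta> x) \<le> B" "\<And>x. norm (gradient \<theta> x) \<le> B"
    using test_function_gradient[OF \<theta>] by metis
  note integrable_L2_inner_bounded[OF _ assms(1) B(2) B(4), of \<phi>] integrable_L2_inner_bounded[OF _ assms(1) B(2) B(4), of \<psi>]
    integrable_L2_inner_bounded[OF _ assms(1) B(1) B(3), of g] integrable_L2_inner_bounded[OF _ assms(1) B(1) B(3), of h]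
  with assms \<theta> show "(LINT x|lebesgue_on \<Omega>. (\<phi> x - \<psi> x) \<bullet> gradient \<theta> x) = - (LINT x|lebesgue_on \<Omega>. (g x - h x) * \<theta> x)"
    by (simp add: inner_diff_left left_diff_distrib has_weak_div_def)
qed

lemma weak_div_unique:
  assumes "open \<Omega>" "\<Omega> \<in> lmeasurable" "g \<in> L2 \<Omega>" "h \<in> L2 \<Omega>"
    and "has_weak_div \<Omega> \<phi> g" "has_weak_div \<Omega> \<phi> h"
  shows "AE x in lebesgue_on \<Omega>. g x = h x"
proof -
  have "AE x in lebesgue_on \<Omega>. g x - h x = 0"
  proof (rule AE_zero_if_orthogonal_to_test_functions[OF assms(1)])
    show "integrable (lebesgue_on \<Omega>) (\<lambda>x. g x - h x)" using assms by (simp add: L2_imp_L1)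
    fix \<theta> :: "real^'a \<Rightarrow> real" assume \<theta>: "\<theta> \<in> test_functions \<Omega>"
    obtain B where B: "\<theta> \<in> borel_measurable borel" "\<And>x. norm (\<theta> x) \<le> B"
      using test_function_gradient[OF \<theta>] by metis
    note integrable_L2_inner_bounded[OF _ assms(2) B, of g] integrable_L2_inner_bounded[OF _ assms(2) B, of h]
    with assms \<theta> show "(LINT x|lebesgue_on \<Omega>. (g x - h x) * \<theta> x) = 0"
      by (simp add: left_diff_distrib has_weak_div_def)
  qed
  then show ?thesis by simp
qed

lemma weak_div_works:
  assumes "\<phi> \<in> D_space \<Omega>"
  shows "weak_div \<Omega> \<phi> \<in> L2 \<Omega>" "has_weak_div \<Omega> \<phi> (weak_div \<Omega> \<phi>)"
proof -
  have "\<exists>g. g \<in> L2 \<Omega> \<and> has_weak_div \<Omega> \<phi> g" using assms by (auto simp: D_space_def)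
  from someI_ex[OF this]
  show "weak_div \<Omega> \<phi> \<in> L2 \<Omega>" "has_weak_div \<Omega> \<phi> (weak_div \<Omega> \<phi>)" by (auto simp: weak_div_def)
qed

lemma test_field_div:
  fixes \<psi> :: "real^'n::finite \<Rightarrow> real^'n"
  assumes "\<psi> \<in> test_functions \<Omega>"
  obtains K where "compact K" "K \<subseteq> \<Omega>" "\<And>x. x \<notin> K \<Longrightarrow> \<psi> x = 0" "\<And>x. x \<notin> K \<Longrightarrow> classical_div \<psi> x = 0"
    "continuous_on UNIV \<psi>" "continuous_on UNIV (classical_div \<psi>)"
proof -
  obtain K where K: "compact K" "K \<subseteq> \<Omega>" "\<And>x. x \<notin> K \<Longrightarrow> \<psi> x = 0" "\<And>x i. x \<notin> K \<Longrightarrow> partial_deriv i \<psi> x = 0"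
    and c: "continuous_on UNIV \<psi>" "\<And>i. continuous_on UNIV (partial_deriv i \<psi>)"
    using test_functionsD[OF assms(1)] by metis
  show ?thesis
    by (rule that[OF K(1-3) _ c(1)]) (use K c in \<open>auto simp: classical_div_def[abs_def] intro!: continuous_intros\<close>)
qed

lemma has_weak_div_classical_div:
  fixes \<psi> :: "real^'n::finite \<Rightarrow> real^'n"
  assumes "\<Omega> \<in> sets lebesgue" "\<psi> \<in> test_functions \<Omega>"
  shows "\<psi> \<in> L2 \<Omega>" "classical_div \<psi> \<in> L2 \<Omega>" "has_weak_div \<Omega> \<psi> (classical_div \<psi>)"
proof -
  obtain K where K: "compact K" "K \<subseteq> \<Omega>" "\<And>x. x \<notin> K \<Longrightarrow> \<psi> x = 0" "\<And>x. x \<notin> K \<Longrightarrow> classical_div \<psi> x = 0"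
    "continuous_on UNIV \<psi>" "continuous_on UNIV (classical_div \<psi>)"
    using test_field_div[OF assms(2)] by metis
  show "\<psi> \<in> L2 \<Omega>" "classical_div \<psi> \<in> L2 \<Omega>"
    using K by (auto intro!: L2_compact_support[OF assms(1) K(1,2)])
  show "has_weak_div \<Omega> \<psi> (classical_div \<psi>)"
    unfolding has_weak_div_def
  proof
    fix \<theta> :: "real^'n \<Rightarrow> real" assume \<theta>: "\<theta> \<in> test_functions \<Omega>"
    obtain c: "continuous_on UNIV \<theta>" "\<And>i. continuous_on UNIV (partial_deriv i \<theta>)"
      and d: "\<And>x. \<theta> differentiable (at x)"
      using test_functionsD[OF \<theta>] by metis
    have cg: "continuous_on UNIV (gradient \<theta>)"
      unfolding gradient_def using c by (intro continuous_intros) auto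
    obtain B where B: "\<And>x. norm (gradient \<theta> x) \<le> B"
      using test_function_gradient[OF \<theta>] by metis
    have 0: "\<psi> x = 0" "classical_div \<psi> x = 0" if "x \<notin> \<Omega>" for x
      using that K(2-4) by blast+
    have z: "(LINT x|lborel. classical_div \<psi> x * \<theta> x + (\<Sum>j\<in>UNIV. \<psi> x $ j * partial_deriv j \<theta> x)) = 0"
    proof (rule gauss_test_field[OF assms(2) c(1)])
      show "partial_deriv j \<theta> \<in> borel_measurable borel" for j
        using c(2) by (rule borel_measurable_continuous_onI)
      show "\<bar>partial_deriv j \<theta> x\<bar> \<le> B" for j x
        using component_le_norm_cart[of "gradient \<theta> x" j] B[of x] by (simp add: gradient_def)
      show "\<exists>S. finite S \<and> (\<forall>t. t \<notin> S \<longrightarrow>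
        ((\<lambda>t. \<theta> (x + t *\<^sub>R axis j 1)) has_real_derivative partial_deriv j \<theta> (x + t *\<^sub>R axis j 1)) (at t))" for j x
        using DERIV_along_axis[OF d]
        by (intro exI[of _ "{}"]) (simp add: has_real_derivative_iff_has_vector_derivative)
    qed
    have eq: "(\<Sum>j\<in>UNIV. \<psi> x $ j * partial_deriv j \<theta> x) = \<psi> x \<bullet> gradient \<theta> x" for x
      by (simp add: inner_vec_def gradient_def)
    have "integrable lborel (\<lambda>x. classical_div \<psi> x * \<theta> x)"
      by (rule integrable_compact_support[OF K(1)]) (use K c in \<open>auto intro!: continuous_intros\<close>)
    moreover have "integrable lborel (\<lambda>x. \<psi> x \<bullet> gradient \<theta> x)"
      by (rule integrable_compact_support[OF K(1)]) (use K cg in \<open>auto intro!: continuous_intros\<close>)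
    ultimately have "(LINT x|lborel. classical_div \<psi> x * \<theta> x) + (LINT x|lborel. \<psi> x \<bullet> gradient \<theta> x) = 0"
      using z by (simp add: eq)
    moreover have "(LINT x|lebesgue_on \<Omega>. classical_div \<psi> x * \<theta> x) = (LINT x|lborel. classical_div \<psi> x * \<theta> x)"
      by (rule integral_lebesgue_on_eq_lborel[OF assms(1)])
        (use K(5,6) c 0 in \<open>auto intro!: continuous_intros borel_measurable_continuous_onI\<close>)
    moreover have "(LINT x|lebesgue_on \<Omega>. \<psi> x \<bullet> gradient \<theta> x) = (LINT x|lborel. \<psi> x \<bullet> gradient \<theta> x)"
      by (rule integral_lebesgue_on_eq_lborel[OF assms(1)])
        (use K(5,6) cg 0 in \<open>auto intro!: continuous_intros borel_measurable_continuous_onI\<close>)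
    ultimately show "(LINT x|lebesgue_on \<Omega>. \<psi> x \<bullet> gradient \<theta> x) = - (LINT x|lebesgue_on \<Omega>. classical_div \<psi> x * \<theta> x)"
      by simp
  qed
qed

text \<open>The chosen representatives of weak divergences are compatible with subtracting a test field, up to
  null sets; this turns an approximation in the graph norm of \<open>D_space\<close> into one of the divergences.\<close>
lemma weak_div_diff_test_field:
  fixes \<phi> :: "real^'n::finite \<Rightarrow> real^'n"
  assumes "open \<Omega>" "\<Omega> \<in> lmeasurable" "\<phi> \<in> D_space \<Omega>" "\<psi> \<in> test_functions \<Omega>"
  shows "(\<lambda>x. \<phi> x - \<psi> x) \<in> D_space \<Omega>"
    and "AE x in lebesgue_on \<Omega>. weak_div \<Omega> (\<lambda>x. \<phi> x - \<psi> x) x = weak_div \<Omega> \<phi> x - classical_div \<psi> x"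
proof -
  have \<Omega>: "\<Omega> \<in> sets lebesgue" using assms(2) by auto
  note \<psi> = has_weak_div_classical_div[OF \<Omega> assms(4)] and \<phi> = weak_div_works[OF assms(3)]
  have \<phi>2: "\<phi> \<in> L2 \<Omega>" using assms(3) by (auto simp: D_space_def)
  have d: "has_weak_div \<Omega> (\<lambda>x. \<phi> x - \<psi> x) (\<lambda>x. weak_div \<Omega> \<phi> x - classical_div \<psi> x)"
    by (rule has_weak_div_diff[OF assms(2) \<phi>2 \<psi>(1) \<phi>(1) \<psi>(2) \<phi>(2) \<psi>(3)])
  have d2: "(\<lambda>x. weak_div \<Omega> \<phi> x - classical_div \<psi> x) \<in> L2 \<Omega>" by (rule L2_diff[OF \<phi>(1) \<psi>(2)])
  show D: "(\<lambda>x. \<phi> x - \<psi> x) \<in> D_space \<Omega>"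
    unfolding D_space_def using d d2 L2_diff[OF \<phi>2 \<psi>(1)] by blast
  show "AE x in lebesgue_on \<Omega>. weak_div \<Omega> (\<lambda>x. \<phi> x - \<psi> x) x = weak_div \<Omega> \<phi> x - classical_div \<psi> x"
    by (rule weak_div_unique[OF assms(1,2) weak_div_works(1)[OF D] d2 weak_div_works(2)[OF D] d])
qed

section \<open>The slab identity\<close>

text \<open>The weight is the truncated coordinate \<open>max \<alpha> (min x\<^sub>i \<beta>) - \<alpha>\<close>, whose gradient is the \<open>i\<close>-th unit
  vector inside the slab and zero outside.\<close>
lemma test_field_slab_identity:
  fixes \<psi> :: "real^'n::finite \<Rightarrow> real^'n"
  assumes "\<psi> \<in> test_functions \<Omega>" "\<Omega> \<in> sets lebesgue" "\<alpha> < \<beta>"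
  shows "(LINT x|lebesgue_on \<Omega>. indicator {x. \<alpha> < x $ i \<and> x $ i < \<beta>} x * \<psi> x $ i
            + classical_div \<psi> x * (max \<alpha> (min (x $ i) \<beta>) - \<alpha>)) = 0"
proof -
  let ?A = "{x :: real^'n. \<alpha> < x $ i \<and> x $ i < \<beta>}"
  let ?v = "\<lambda>x :: real^'n. max \<alpha> (min (x $ i) \<beta>) - \<alpha>"
  define D where "D j x = (if j = i then indicator ?A x else 0 :: real)" for j and x
  obtain K where K: "compact K" "K \<subseteq> \<Omega>" "\<And>x. x \<notin> K \<Longrightarrow> \<psi> x = 0" "\<And>x. x \<notin> K \<Longrightarrow> classical_div \<psi> x = 0"
    "continuous_on UNIV \<psi>" "continuous_on UNIV (classical_div \<psi>)"
    using test_field_div[OF assms(1)] by metis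
  have v: "continuous_on UNIV ?v" by (intro continuous_intros)
  have A[measurable]: "?A \<in> sets borel" by measurable
  have "(LINT x|lborel. classical_div \<psi> x * ?v x + (\<Sum>j\<in>UNIV. \<psi> x $ j * D j x)) = 0"
  proof (rule gauss_test_field[OF assms(1) v])
    show "D j \<in> borel_measurable borel" for j
      unfolding D_def by (cases "j = i") simp_all
    show "\<bar>D j x\<bar> \<le> 1" for j x by (auto simp: D_def indicator_def)
    fix j :: 'n and x :: "real^'n"
    let ?y = "\<lambda>t. x + t *\<^sub>R axis j (1::real)"
    show "\<exists>S. finite S \<and> (\<forall>t. t \<notin> S \<longrightarrow> ((\<lambda>t. ?v (?y t)) has_real_derivative D j (?y t)) (at t))"
    proof (cases "j = i")
      case False
      then show ?thesis by (intro exI[of _ "{}"]) (simp add: D_def axis_def)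
    next
      case True
      have "((\<lambda>t. ?v (?y t)) has_real_derivative D j (?y t)) (at t)"
        if "t \<notin> {\<alpha> - x $ i, \<beta> - x $ i}" for t
      proof -
        from that consider "x $ i + t < \<alpha>" | "\<alpha> < x $ i + t" "x $ i + t < \<beta>" | "\<beta> < x $ i + t"
          by force
        then show ?thesis
        proof cases
          case 1
          have "((\<lambda>t. 0) has_real_derivative D j (?y t)) (at t)"
            using 1 True by (simp add: D_def axis_def)
          then show ?thesis
            by (rule has_field_derivative_transform_within_open[where S = "{..<\<alpha> - x $ i}"])
               (use 1 True in \<open>auto simp: axis_def\<close>)
        next
          case 2
          have "((\<lambda>t. x $ i + t - \<alpha>) has_real_derivative D j (?y t)) (at t)"
            using 2 True by (auto simp: D_def axis_def intro!: derivative_eq_intros)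
          then show ?thesis
            by (rule has_field_derivative_transform_within_open[where S = "{\<alpha> - x $ i<..<\<beta> - x $ i}"])
               (use 2 True in \<open>auto simp: axis_def\<close>)
        next
          case 3
          have "((\<lambda>t. \<beta> - \<alpha>) has_real_derivative D j (?y t)) (at t)"
            using 3 True by (simp add: D_def axis_def)
          then show ?thesis
            by (rule has_field_derivative_transform_within_open[where S = "{\<beta> - x $ i<..}"])
               (use 3 True assms(3) in \<open>auto simp: axis_def\<close>)
        qed
      qed
      then show ?thesis by (intro exI[of _ "{\<alpha> - x $ i, \<beta> - x $ i}"]) auto
    qed
  qed
  moreover have "(\<Sum>j\<in>UNIV. \<psi> x $ j * D j x) = indicator ?A x * \<psi> x $ i" for x
    by (simp add: D_def if_distrib[of "\<lambda>c. _ * c"] mult.commute cong: if_cong)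
  ultimately have *: "(LINT x|lborel. indicator ?A x * \<psi> x $ i + classical_div \<psi> x * ?v x) = 0"
    by (simp add: add.commute)
  have [measurable]: "(\<lambda>x. \<psi> x $ i) \<in> borel_measurable borel" "classical_div \<psi> \<in> borel_measurable borel"
    "?v \<in> borel_measurable borel"
    using K(5,6) v by (auto intro!: borel_measurable_continuous_onI continuous_intros)
  have 0: "\<psi> x = 0" "classical_div \<psi> x = 0" if "x \<notin> \<Omega>" for x
    using that K(2-4) by blast+
  have "integral\<^sup>L (lebesgue_on \<Omega>) (\<lambda>x. indicator ?A x * \<psi> x $ i + classical_div \<psi> x * ?v x) =
      integral\<^sup>L lborel (\<lambda>x. indicator ?A x * \<psi> x $ i + classical_div \<psi> x * ?v x)"
    by (rule integral_lebesgue_on_eq_lborel(1)[OF assms(2)]) (measurable, simp add: 0)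
  with * show ?thesis by simp
qed

text \<open>The identity passes to the closure because both of its terms are continuous with respect to the
  graph norm on a set of finite measure.\<close>
lemma D0_slab_identity:
  fixes \<phi> :: "real^'n::finite \<Rightarrow> real^'n"
  assumes "open \<Omega>" "bounded \<Omega>" "\<phi> \<in> D0_space \<Omega>" "\<alpha> < \<beta>"
  shows "(LINT x|lebesgue_on \<Omega>. indicator {x. \<alpha> < x $ i \<and> x $ i < \<beta>} x * \<phi> x $ i
            + weak_div \<Omega> \<phi> x * (max \<alpha> (min (x $ i) \<beta>) - \<alpha>)) = 0"
    (is "integral\<^sup>L ?M ?F = 0")
proof -
  let ?A = "{x :: real^'n. \<alpha> < x $ i \<and> x $ i < \<beta>}"
  let ?v = "\<lambda>x :: real^'n. max \<alpha> (min (x $ i) \<beta>) - \<alpha>"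
  have lm: "\<Omega> \<in> lmeasurable" using assms(1,2) by (simp add: lmeasurable_open)
  then have \<Omega>: "\<Omega> \<in> sets lebesgue" by auto
  have \<phi>D: "\<phi> \<in> D_space \<Omega>" using assms(3) by (simp add: D0_space_def)
  have A[measurable]: "?A \<in> sets borel" by measurable
  have vb: "\<bar>?v x\<bar> \<le> \<beta> - \<alpha>" for x using assms(4) by auto
  have vm: "?v \<in> borel_measurable borel" by measurable
  \<comment> \<open>The integrand for an arbitrary field \<open>f\<close> and a function \<open>g\<close> in the place of its divergence; it is
    linear in the pair \<open>(f, g)\<close>.\<close>
  define T where "T f g x = indicator ?A x * f x $ i + g x * ?v x"
    for f :: "real^'n \<Rightarrow> real^'n" and g :: "real^'n \<Rightarrow> real" and x
  have iT: "integrable ?M (T f g)" if "f \<in> L2 \<Omega>" "g \<in> L2 \<Omega>" for f g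
  proof -
    have "integrable ?M (\<lambda>x. f x \<bullet> (indicator ?A x *\<^sub>R axis i 1))"
      by (rule integrable_L2_inner_bounded[OF that(1) lm, where B = 1]) (auto simp: indicator_def)
    moreover have "integrable ?M (\<lambda>x. g x \<bullet> ?v x)"
      by (rule integrable_L2_inner_bounded[OF that(2) lm vm, where B = "\<beta> - \<alpha>"]) (use vb in auto)
    ultimately show ?thesis by (simp add: T_def[abs_def] inner_axis)
  qed
  define C where "C = (1 + (\<beta> - \<alpha>)) * (measure lebesgue \<Omega> + 1)"
  have bT: "\<bar>integral\<^sup>L ?M (T f g)\<bar> \<le> \<epsilon> * C"
    if "f \<in> L2 \<Omega>" "g \<in> L2 \<Omega>" "L2_norm \<Omega> f \<le> \<epsilon>" "L2_norm \<Omega> g \<le> \<epsilon>" "\<epsilon> > 0" for f g \<epsilon>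
  proof -
    have i: "integrable ?M f" "integrable ?M g" using that lm by (auto intro: L2_imp_L1)
    have "\<bar>integral\<^sup>L ?M (T f g)\<bar> \<le> (LINT x|?M. \<bar>T f g x\<bar>)"
      by (rule integral_abs_bound)
    also have "\<dots> \<le> (LINT x|?M. norm (f x) + (\<beta> - \<alpha>) * norm (g x))"
    proof (rule integral_mono)
      show "integrable ?M (\<lambda>x. \<bar>T f g x\<bar>)" using iT that by simp
      show "integrable ?M (\<lambda>x. norm (f x) + (\<beta> - \<alpha>) * norm (g x))" using i by simp
      fix x
      have "\<bar>indicator ?A x * f x $ i\<bar> \<le> norm (f x)"
        using component_le_norm_cart[of "f x" i] by (auto simp: indicator_def)
      moreover have "\<bar>g x * ?v x\<bar> \<le> (\<beta> - \<alpha>) * norm (g x)"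
        using vb[of x] by (simp add: abs_mult mult.commute[of "\<beta> - \<alpha>"] mult_left_mono)
      ultimately show "\<bar>T f g x\<bar> \<le> norm (f x) + (\<beta> - \<alpha>) * norm (g x)"
        unfolding T_def by linarith
    qed
    also have "\<dots> = L1_norm \<Omega> f + (\<beta> - \<alpha>) * L1_norm \<Omega> g"
      using i by (simp add: L1_norm_def)
    also have "\<dots> \<le> \<epsilon> * (measure lebesgue \<Omega> + 1) / 2 + (\<beta> - \<alpha>) * (\<epsilon> * (measure lebesgue \<Omega> + 1) / 2)"
      using that lm assms(4) by (intro add_mono mult_left_mono L1_norm_le_of_L2_norm_le) auto
    also have "\<dots> = \<epsilon> * C / 2" by (simp add: C_def field_simps)
    also have "\<dots> \<le> \<epsilon> * C" using that(5) assms(4) by (simp add: C_def)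
    finally show ?thesis .
  qed
  have "\<bar>integral\<^sup>L ?M ?F\<bar> \<le> \<epsilon> * C" if "\<epsilon> > 0" for \<epsilon>
  proof -
    obtain \<psi> :: "real^'n \<Rightarrow> real^'n" where \<psi>: "\<psi> \<in> test_functions \<Omega>" "D_norm \<Omega> (\<lambda>x. \<phi> x - \<psi> x) < \<epsilon>"
      using assms(3) \<open>\<epsilon> > 0\<close> by (auto simp: D0_space_def)
    let ?f = "\<lambda>x. \<phi> x - \<psi> x"
    let ?h = "weak_div \<Omega> ?f"
    note W = weak_div_diff_test_field[OF assms(1) lm \<phi>D \<psi>(1)]
    have f: "?f \<in> L2 \<Omega>" using W(1) by (simp add: D_space_def)
    have h: "?h \<in> L2 \<Omega>" using W(1) by (rule weak_div_works)
    have "L2_norm \<Omega> ?f \<le> D_norm \<Omega> ?f" "L2_norm \<Omega> ?h \<le> D_norm \<Omega> ?f"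
      unfolding D_norm_def by (auto intro!: real_le_rsqrt)
    with \<psi>(2) have n: "L2_norm \<Omega> ?f \<le> \<epsilon>" "L2_norm \<Omega> ?h \<le> \<epsilon>" by auto
    note \<psi>L = has_weak_div_classical_div(1,2)[OF \<Omega> \<psi>(1)]
    have "integral\<^sup>L ?M ?F = (LINT x|?M. T ?f ?h x + T \<psi> (classical_div \<psi>) x)"
    proof (rule integral_cong_AE)
      have "integrable ?M ?F"
        using iT[OF _ weak_div_works(1)[OF \<phi>D], of \<phi>] \<phi>D unfolding T_def D_space_def by auto
      then show "?F \<in> borel_measurable ?M" by auto
      show "(\<lambda>x. T ?f ?h x + T \<psi> (classical_div \<psi>) x) \<in> borel_measurable ?M"
        using iT[OF f h] iT[OF \<psi>L] by (intro borel_measurable_add) auto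
      show "AE x in ?M. ?F x = T ?f ?h x + T \<psi> (classical_div \<psi>) x"
        using W(2)
      proof eventually_elim
        case (elim x)
        show ?case
          unfolding T_def elim vector_minus_component by (simp only: algebra_simps)
      qed
    qed
    also have "\<dots> = integral\<^sup>L ?M (T ?f ?h) + integral\<^sup>L ?M (T \<psi> (classical_div \<psi>))"
      by (rule Bochner_Integration.integral_add[OF iT[OF f h] iT[OF \<psi>L]])
    also have "integral\<^sup>L ?M (T \<psi> (classical_div \<psi>)) = 0"
      unfolding T_def by (rule test_field_slab_identity[OF \<psi>(1) \<Omega> assms(4)])
    finally show ?thesis using bT[OF f h n that] by simp
  qed
  note small = this
  have "C > 0" using assms(4) by (auto simp: C_def intro!: mult_pos_pos add_pos_nonneg add_nonneg_pos)
  have "\<bar>integral\<^sup>L ?M ?F\<bar> \<le> 0"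
  proof (rule field_le_epsilon)
    fix e :: real assume "e > 0"
    then show "\<bar>integral\<^sup>L ?M ?F\<bar> \<le> 0 + e" using small[of "e / C"] \<open>C > 0\<close> by simp
  qed
  then show ?thesis by simp
qed

theorem theorem1:
  fixes \<Omega> :: "(real^3) set" and l :: "real^3" and \<phi> :: "real^3 \<Rightarrow> real^3"
    and i :: 3 and \<alpha> \<beta> :: real
  assumes "open \<Omega>" and "connected \<Omega>" and "\<Omega> \<noteq> {}" and "bounded \<Omega>"
    and "smallest_box \<Omega> l"
    and "\<phi> \<in> D0_space \<Omega>"
    and "0 \<le> \<alpha>" and "\<alpha> < \<beta>" and "\<beta> \<le> l $ i"
  shows "\<bar>LINT x|lebesgue_on {x \<in> \<Omega>. \<alpha> < x $ i \<and> x $ i < \<beta>}. \<phi> x $ i\<bar>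
           \<le> (\<beta> - \<alpha>) * L1_norm \<Omega> (weak_div \<Omega> \<phi>)"
proof -
  let ?A = "{x :: real^3. \<alpha> < x $ i \<and> x $ i < \<beta>}"
  let ?v = "\<lambda>x :: real^3. max \<alpha> (min (x $ i) \<beta>) - \<alpha>"
  let ?M = "lebesgue_on \<Omega>" and ?g = "weak_div \<Omega> \<phi>"
  have lm: "\<Omega> \<in> lmeasurable" using assms by (simp add: lmeasurable_open)
  then have \<Omega>: "\<Omega> \<in> sets lebesgue" by auto
  have A[measurable]: "?A \<in> sets borel" by measurable
  have vb: "\<bar>?v x\<bar> \<le> \<beta> - \<alpha>" for x using assms(8) by auto
  have vm: "?v \<in> borel_measurable borel" by measurable
  have \<phi>: "\<phi> \<in> D_space \<Omega>" "\<phi> \<in> L2 \<Omega>" using assms(6) by (auto simp: D0_space_def D_space_def)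
  have gL: "?g \<in> L2 \<Omega>" using weak_div_works(1) \<phi>(1) .
  have gi: "integrable ?M ?g" using L2_imp_L1 gL lm .
  have i1: "integrable ?M (\<lambda>x. indicator ?A x * \<phi> x $ i)"
    using integrable_L2_inner_bounded[OF \<phi>(2) lm, of "\<lambda>x. indicator ?A x *\<^sub>R axis i 1" 1]
    by (simp add: inner_axis indicator_def)
  have i2: "integrable ?M (\<lambda>x. ?g x * ?v x)"
    using integrable_L2_inner_bounded[OF gL lm vm, of "\<beta> - \<alpha>"] vb by simp
  have "(LINT x|lebesgue_on {x \<in> \<Omega>. \<alpha> < x $ i \<and> x $ i < \<beta>}. \<phi> x $ i) = (LINT x|lebesgue_on (\<Omega> \<inter> ?A). \<phi> x $ i)"
    by (simp add: Int_def)
  also have "\<dots> = (LINT x|?M. indicator ?A x * \<phi> x $ i)"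
  proof -
    have "?A \<in> sets lebesgue" using A by simp
    then have "\<Omega> \<inter> ?A \<in> sets lebesgue" using \<Omega> by blast
    then show ?thesis
      using \<Omega> by (simp add: integral_restrict_space indicator_inter_arith mult.assoc)
  qed
  also have "\<dots> = - (LINT x|?M. ?g x * ?v x)"
    using D0_slab_identity[OF assms(1,4,6,8), of i] i1 i2 by simp
  finally have "\<bar>LINT x|lebesgue_on {x \<in> \<Omega>. \<alpha> < x $ i \<and> x $ i < \<beta>}. \<phi> x $ i\<bar> = \<bar>LINT x|?M. ?g x * ?v x\<bar>"
    by simp
  also have "\<dots> \<le> (LINT x|?M. \<bar>?g x * ?v x\<bar>)" by (rule integral_abs_bound)
  also have "\<dots> \<le> (LINT x|?M. (\<beta> - \<alpha>) * norm (?g x))"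
  proof (rule integral_mono)
    show "\<bar>?g x * ?v x\<bar> \<le> (\<beta> - \<alpha>) * norm (?g x)" for x
      using vb[of x] by (simp add: abs_mult mult.commute[of "\<beta> - \<alpha>"] mult_left_mono)
  qed (use i2 gi in auto)
  also have "\<dots> = (\<beta> - \<alpha>) * L1_norm \<Omega> ?g" by (simp add: L1_norm_def)
  finally show ?thesis .
qed

end
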